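(* Let $R$ be a commutative ring, let $\lambda\in\{\pm 1\}$, and let $\underline{c}=(c_1,\ldots,c_m)\in R^m$ be a $\lambda$-quiddity cycle over $R$. Then $\underline{c}$ is reducible over $R$ if and only if the (tame) frieze pattern of $\underline{c}$ contains an entry equal to $1$ or $-1$, i.e. if and only if there exist $i,j\in\mathbb{Z}$ with $i+2\le j\le i+m-2$ and $x_{i,j}\in\{1,-1\}$.
   Context: For $c$ in a commutative ring let $\eta(c):=\begin{pmatrix} c & -1\\ 1 & 0\end{pmatrix}$. Let $R$ be a subset of a commutative ring and $\lambda\in\{\pm1\}$. A $\lambda$-quiddity cycle over $R$ is a sequence $(c_1,\ldots,c_m)\in R^m$ ($m>0$) with $\prod_{k=1}^m\eta(c_k)=\eta(c_1)\eta(c_2)\cdots\eta(c_m)=\lambda\,\mathrm{id}$, where $\mathrm{id}$ is the $2\times 2$ identity matrix. Let $D_m$ be the dihedral group with $2m$ elements acting on $\{1,\ldots,m\}$ (by rotations and reflections of the cyclically ordered indices); for $\sigma\in D_m$ write $(c_1,\ldots,c_m)^\sigma:=(c_{\sigma(1)},\ldots,c_{\sigma(m)})$. The sum of a $\lambda'$-quiddity cycle $(a_1,\ldots,a_k)$ and a $\lambda''$-quiddity cycle $(b_1,\ldots,b_\ell)$ is the sequence of length $k+\ell-2$ $$(a_1,\ldots,a_k)\oplus(b_1,\ldots,b_\ell):=(a_1+b_\ell,a_2,\ldots,a_{k-1},a_k+b_1,b_2,\ldots,b_{\ell-1}).$$ A $\lambda$-quiddity cycle $(c_1,\ldots,c_m)\in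 R^m$ with $m>2$ is called reducible over $R$ if there exist a $\lambda'$-quiddity cycle $(a_1,\ldots,a_k)\in R^k$, a $\lambda''$-quiddity cycle $(b_1,\ldots,b_\ell)\in R^\ell$ (with $\lambda',\lambda''\in\{\pm1\}$), and $\sigma\in D_m$ such that $\lambda=-\lambda'\lambda''$, $k,\ell>2$ and $(c_1,\ldots,c_m)^\sigma=(a_1,\ldots,a_k)\oplus(b_1,\ldots,b_\ell)$. (Cycles of length at most $2$ are not called reducible.) Frieze pattern of a $\lambda$-quiddity cycle $\underline{c}=(c_1,\ldots,c_m)$: define $c_k$ for all $k\in\mathbb{Z}$ by repeating $\underline{c}$ periodically with period $m$. For $i,j\in\mathbb{Z}$ put $x_{i,j}:=\left(\prod_{k=i}^{j-2}\eta(c_k)\right)_{1,1}$ (the upper left entry, factors in increasing order of $k$) if $i\le j-2$, $x_{i,i+1}:=1$, and $x_{i,i}:=0$. The array $(x_{i,j})_{i\le j\le i+m}$ is the frieze pattern of $\underline{c}$; its entries (i.e. those not on the border) are by definition the elements $x_{i,j}$ with $i+2\le j\le i+m-2$. *)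

theory Defs
  imports "Jordan_Normal_Form.Matrix" "HOL-Combinatorics.Permutations"
begin

text \<open>
  Coefficients have sort \<open>{comm_ring, comm_monoid_mult}\<close>, i.e. they form an arbitrary commutative
  ring with unit.  The class \<open>comm_ring_1\<close> is a subclass that additionally demands \<open>0 \<noteq> 1\<close>
  and would exclude the zero ring.
\<close>

definition eta :: "'a::{comm_ring, comm_monoid_mult} \<Rightarrow> 'a mat" where
  "eta c = mat_of_rows_list 2 [[c, - 1], [1, 0]]"

definition eta_prod :: "'a::{comm_ring, comm_monoid_mult} list \<Rightarrow> 'a mat" where
  "eta_prod cs = foldr (\<lambda>c M. eta c * M) cs (1\<^sub>m 2)"

text \<open>The list \<open>[c\<^sub>1, \<dots>, c\<^sub>m]\<close> represents the sequence \<open>(c\<^sub>1, \<dots>, c\<^sub>m)\<close>, so \<open>c\<^sub>k\<close> is \<open>cs ! (k - 1)\<close>.\<close>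

definition quiddity_cycle ::
    "'a::{comm_ring, comm_monoid_mult} set \<Rightarrow> 'a \<Rightarrow> 'a list \<Rightarrow> bool" where
  "quiddity_cycle R lam cs \<longleftrightarrow>
     lam \<in> {1, - 1} \<and> cs \<noteq> [] \<and> set cs \<subseteq> R \<and> eta_prod cs = lam \<cdot>\<^sub>m 1\<^sub>m 2"

text \<open>
  The rotations and reflections of the cyclically ordered indices \<open>0, \<dots>, m - 1\<close>.  As
  permutations they number \<open>2 * m\<close> only for \<open>m > 2\<close>, the only case in which they are used.
\<close>

definition dihedral :: "nat \<Rightarrow> (nat \<Rightarrow> nat) set" where
  "dihedral m =
     {\<sigma>. \<sigma> permutes {..<m} \<and>
        (\<exists>s\<in>{1, - 1}. \<exists>a. \<forall>i<m. int (\<sigma> i) = (a + s * int i) mod int m)}"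

text \<open>Both lists are meant to have length at least \<open>2\<close>.\<close>

definition quiddity_sum :: "'a::plus list \<Rightarrow> 'a list \<Rightarrow> 'a list" where
  "quiddity_sum as bs =
     (hd as + last bs) # butlast (tl as) @ (last as + hd bs) # butlast (tl bs)"

definition reducible ::
    "'a::{comm_ring, comm_monoid_mult} set \<Rightarrow> 'a \<Rightarrow> 'a list \<Rightarrow> bool" where
  "reducible R lam cs \<longleftrightarrow>
     quiddity_cycle R lam cs \<and> length cs > 2 \<and>
     (\<exists>lam' lam'' as bs. \<exists>\<sigma> \<in> dihedral (length cs).
        quiddity_cycle R lam' as \<and> quiddity_cycle R lam'' bs \<and>
        lam = - (lam' * lam'') \<and> length as > 2 \<and> length bs > 2 \<and>
        permute_list \<sigma> cs = quiddity_sum as bs)"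

definition periodic_ext :: "'a list \<Rightarrow> int \<Rightarrow> 'a" where
  "periodic_ext cs k = cs ! nat ((k - 1) mod int (length cs))"

text \<open>Only meant for \<open>i \<le> j\<close>, in which range it gives the frieze pattern.\<close>

definition frieze :: "'a::{comm_ring, comm_monoid_mult} list \<Rightarrow> int \<Rightarrow> int \<Rightarrow> 'a" where
  "frieze cs i j =
     (if j = i then 0
      else if j = i + 1 then 1
      else eta_prod (map (periodic_ext cs) [i..j - 2]) $$ (0, 0))"

end

theory Submission
  imports Defs
begin

text \<open>
  Write a cyclically ordered sequence with product \<open>\<lambda> id\<close> as \<open>(u, d, v, e)\<close>, where \<open>d\<close> and \<open>e\<close>
  are nonempty blocks and \<open>u\<close>, \<open>v\<close> are the two terms between them.  To split it as a sum whose
  first summand is \<open>(a, d, b)\<close> means to choose \<open>a\<close> and \<open>b\<close> with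
  \<open>\<eta>(a) M(d) \<eta>(b) = \<lambda>' id\<close>, where \<open>M(d)\<close> is the product of the \<open>\<eta>\<close>-matrices of the block
  \<open>d\<close>.  The lower right entry of \<open>\<eta>(a) M(d) \<eta>(b)\<close> is \<open>- M(d)\<^sub>1\<^sub>1\<close> for all \<open>a\<close>, \<open>b\<close>, so
  \<open>M(d)\<^sub>1\<^sub>1 = - \<lambda>'\<close> is necessary.  It is also sufficient: when \<open>M(d)\<^sub>1\<^sub>1\<close> is a sign, the two
  off-diagonal entries can be cleared by the choice of \<open>a\<close> and \<open>b\<close>, and \<open>det M(d) = 1\<close> forces the
  remaining entry (\<open>close_block\<close>).  The complementary sequence \<open>(v - b, e, u - a)\<close> is then a
  quiddity cycle as well: the scalar \<open>\<eta>(a) M(d) \<eta>(b)\<close> can be cancelled from the full product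
  (\<open>eta_prod_seams\<close>), and a product equal to a scalar matrix stays so under cyclic rotation.

  The entries of the frieze pattern are exactly the numbers \<open>M(d)\<^sub>1\<^sub>1\<close> for the contiguous blocks
  \<open>d\<close> of the cyclic sequence that leave at least three terms outside.  Rotations of the indices
  only move these blocks, and reflections reverse them, which does not change \<open>M(d)\<^sub>1\<^sub>1\<close>
  (\<open>eta_prod_rev\<close>).
\<close>

section \<open>Two by two matrices\<close>

text \<open>
  The coefficient ring may be the zero ring, so the algebra of identity matrices is derived here
  from explicit entries.
\<close>

definition mat2 :: "'a \<Rightarrow> 'a \<Rightarrow> 'a \<Rightarrow> 'a \<Rightarrow> 'a mat" where
  "mat2 p q r s = mat_of_rows_list 2 [[p, q], [r, s]]"

lemma mat2_dim [simp]: "dim_row (mat2 p q r s) = 2" "dim_col (mat2 p q r s) = 2"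
  by (simp_all add: mat2_def mat_of_rows_list_def)

lemma mat2_carrier [simp]: "mat2 p q r s \<in> carrier_mat 2 2"
  by (rule carrier_matI) simp_all

lemma mat2_index [simp]:
  "mat2 p q r s $$ (0, 0) = p" "mat2 p q r s $$ (0, Suc 0) = q"
  "mat2 p q r s $$ (Suc 0, 0) = r" "mat2 p q r s $$ (Suc 0, Suc 0) = s"
  by (simp_all add: mat2_def mat_of_rows_list_def)

lemma mat2_eq_iff [simp]:
  "mat2 p q r s = mat2 p' q' r' s' \<longleftrightarrow> p = p' \<and> q = q' \<and> r = r' \<and> s = s'"
  by (metis mat2_index)

lemma mat2_eqI:
  assumes "A \<in> carrier_mat 2 2"
    and "A $$ (0, 0) = p" "A $$ (0, 1) = q" "A $$ (1, 0) = r" "A $$ (1, 1) = s"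
  shows "A = mat2 p q r s"
  by (rule eq_matI) (use assms in \<open>auto simp: numeral_2_eq_2 less_Suc_eq\<close>)

lemma mat2_cases:
  assumes "A \<in> carrier_mat 2 2"
  obtains p q r s where "A = mat2 p q r s"
  using mat2_eqI[OF assms refl refl refl refl] by blast

lemma mat2_mult [simp]:
  fixes p :: "'a::comm_ring"
  shows "mat2 p q r s * mat2 p' q' r' s' =
    mat2 (p * p' + q * r') (p * q' + q * s') (r * p' + s * r') (r * q' + s * s')"
proof -
  have "(\<Sum>i = 0..<2. f i) = f 0 + f (Suc 0)" for f :: "nat \<Rightarrow> 'a"
    by (simp add: numeral_2_eq_2)
  then show ?thesis
    by (intro mat2_eqI mult_carrier_mat[where n = 2]) (simp_all add: scalar_prod_def)
qed

lemma scalar_mat2: "x \<cdot>\<^sub>m 1\<^sub>m 2 = mat2 x 0 0 (x::'a::{comm_ring, comm_monoid_mult})"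
  by (rule mat2_eqI) auto

lemma one_mat2: "1\<^sub>m 2 = mat2 1 0 0 (1::'a::{comm_ring, comm_monoid_mult})"
  by (rule mat2_eqI) auto

section \<open>Products of eta matrices\<close>

lemma eta_mat2: "eta c = mat2 c (- 1) 1 0"
  by (simp add: eta_def mat2_def)

lemma eta_prod_Nil [simp]: "eta_prod [] = mat2 1 0 0 1"
  by (simp add: eta_prod_def one_mat2)

lemma eta_prod_Cons [simp]: "eta_prod (c # cs) = mat2 c (- 1) 1 0 * eta_prod cs"
  by (simp add: eta_prod_def eta_mat2)

lemma eta_prod_carrier [simp]: "eta_prod cs \<in> carrier_mat 2 2"
  by (induction cs) (simp_all add: mult_carrier_mat[where n = 2])

lemma eta_prod_append: "eta_prod (xs @ ys) = eta_prod xs * eta_prod ys"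
proof (induction xs)
  case Nil
  obtain p q r s where "eta_prod ys = mat2 p q r s"
    using eta_prod_carrier by (rule mat2_cases)
  then show ?case by simp
next
  case (Cons x xs)
  then show ?case by (simp add: assoc_mult_mat[where ?n\<^sub>1 = 2 and ?n\<^sub>2 = 2 and ?n\<^sub>3 = 2 and ?n\<^sub>4 = 2])
qed

lemma eta_prod_det: "eta_prod cs = mat2 p q r s \<Longrightarrow> p * s - q * r = 1"
proof (induction cs arbitrary: p q r s)
  case (Cons c cs)
  obtain p' q' r' s' where A: "eta_prod cs = mat2 p' q' r' s'"
    using eta_prod_carrier by (rule mat2_cases)
  with Cons.prems have entries: "p = c * p' - r'" "q = c * q' - s'" "r = p'" "s = q'"
    by auto
  show ?case unfolding entries using Cons.IH[OF A] by (simp add: algebra_simps)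
qed auto

text \<open>
  The map \<open>(p, q, r, s) \<mapsto> (p, - r, - q, s)\<close> is an anti-automorphism, transposition followed by
  conjugation with \<open>diag(1, -1)\<close>, and it fixes every \<open>\<eta>(c)\<close>.
\<close>
lemma eta_prod_rev: "eta_prod cs = mat2 p q r s \<Longrightarrow> eta_prod (rev cs) = mat2 p (- r) (- q) s"
proof (induction cs arbitrary: p q r s)
  case (Cons c cs)
  obtain p' q' r' s' where A: "eta_prod cs = mat2 p' q' r' s'"
    using eta_prod_carrier by (rule mat2_cases)
  from Cons.IH[OF A] Cons.prems A show ?case by (auto simp: eta_prod_append algebra_simps)
qed auto

lemma eta_prod_rev_upper_left: "eta_prod (rev cs) $$ (0, 0) = eta_prod cs $$ (0, 0)"
proof -
  obtain p q r s where A: "eta_prod cs = mat2 p q r s"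
    using eta_prod_carrier by (rule mat2_cases)
  show ?thesis using eta_prod_rev[OF A] A by simp
qed

text \<open>Scalar matrices are central and \<open>\<eta>(x)\<close> is invertible, so one term may change sides.\<close>
lemma eta_prod_scalar_rotate1:
  assumes "eta_prod (x # xs) = mat2 lam 0 0 lam"
  shows "eta_prod (xs @ [x]) = mat2 lam 0 0 lam"
proof -
  obtain p q r s where A: "eta_prod xs = mat2 p q r s"
    using eta_prod_carrier by (rule mat2_cases)
  with assms have "p = 0" "q = lam" "r = - lam" "s = x * lam"
    by auto
  with A show ?thesis by (simp add: eta_prod_append algebra_simps)
qed

lemma eta_prod_scalar_rotate:
  assumes "eta_prod cs = mat2 lam 0 0 lam"
  shows "eta_prod (rotate n cs) = mat2 lam 0 0 lam"
proof (induction n)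
  case (Suc n)
  then show ?case
    by (cases "rotate n cs") (simp_all add: eta_prod_scalar_rotate1 del: eta_prod_Cons)
qed (simp add: assms)

section \<open>Splitting a cycle along a block\<close>

lemma eta_prod_enclosed_lower_right:
  assumes "eta_prod (a # ds @ [b]) = mat2 lam 0 0 lam"
  shows "eta_prod ds $$ (0, 0) = - lam"
proof -
  obtain p q r s where D: "eta_prod ds = mat2 p q r s"
    using eta_prod_carrier by (rule mat2_cases)
  then have "eta_prod (a # ds @ [b]) $$ (1, 1) = - p"
    by (simp add: eta_prod_append)
  with assms D show ?thesis by (simp del: eta_prod_Cons)
qed

text \<open>
  With \<open>M(d) = (e, q, r, s)\<close> the off-diagonal entries of \<open>\<eta>(a) M(d) \<eta>(b)\<close> are \<open>r - e a\<close> and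
  \<open>e b + q\<close>; since \<open>e\<close> is its own inverse, they vanish for \<open>a = e r\<close> and \<open>b = - e q\<close>.
\<close>
lemma close_block:
  assumes "eta_prod ds $$ (0, 0) = e" and e: "e \<in> {1, - 1}"
  obtains a b where "eta_prod (a # ds @ [b]) = mat2 (- e) 0 0 (- e)"
proof -
  obtain q r s where A: "eta_prod ds = mat2 e q r s"
    using mat2_eqI[OF eta_prod_carrier assms(1) refl refl refl] by blast
  from eta_prod_det[OF this] have "q * r = e * s - 1"
    by (simp add: algebra_simps)
  with A e have "eta_prod (e * r # ds @ [- (e * q)]) = mat2 (- e) 0 0 (- e)"
    by (auto simp: eta_prod_append algebra_simps)
  then show ?thesis by (rule that)
qed

text \<open>
  At a seam, where the two summands overlap, the second one contributes a
  unipotent factor: with \<open>U = (1, y; 0, 1)\<close> and \<open>L = (1, 0; - x, 1)\<close> one has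
  \<open>\<eta>(a + y) = U \<eta>(a)\<close> and \<open>\<eta>(b + x) = \<eta>(b) L\<close>, while \<open>\<eta>(y) \<eta>(x) = - U L\<close>.
  Hence the full product is \<open>U (l id) L M(e)\<close>, in which the scalar moves to the front.
\<close>
lemma eta_prod_seams:
  assumes A: "eta_prod (a # ds @ [b]) = mat2 l 0 0 l"
    and "eta_prod ((a + y) # ds @ (b + x) # es) = mat2 lam 0 0 lam"
  shows "mat2 l 0 0 l * eta_prod (y # x # es) = mat2 (- lam) 0 0 (- lam)"
proof -
  obtain p q r s where E: "eta_prod es = mat2 p q r s"
    using eta_prod_carrier by (rule mat2_cases)
  note assoc = assoc_mult_mat[where ?n\<^sub>1 = 2 and ?n\<^sub>2 = 2 and ?n\<^sub>3 = 2 and ?n\<^sub>4 = 2]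
  note [simp] = mult_carrier_mat[where n = 2]
  have U: "mat2 (a + y) (- 1) 1 0 = mat2 1 y 0 1 * mat2 a (- 1) 1 0"
    and L: "mat2 (b + x) (- 1) 1 0 = mat2 b (- 1) 1 0 * mat2 1 0 (- x) 1"
    by simp_all
  have "eta_prod ((a + y) # ds @ (b + x) # es) =
      mat2 1 y 0 1 * eta_prod (a # ds @ [b]) * (mat2 1 0 (- x) 1 * eta_prod es)"
    by (simp add: eta_prod_append U L assoc del: mat2_mult)
       (simp add: E)
  with assms have "mat2 1 y 0 1 * mat2 l 0 0 l * (mat2 1 0 (- x) 1 * eta_prod es) =
      mat2 lam 0 0 lam"
    by simp
  then show ?thesis
    by (simp add: E algebra_simps)
qed

text \<open>
  The block determines the outer terms of the first summand, and the seams then determine the second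
  summand; the seam lemma delivers it starting at its last term \<open>y\<close>, hence the final rotation.
\<close>
lemma split_cycle:
  assumes cycle: "eta_prod (u # ds @ v # es) = mat2 lam 0 0 lam"
    and entry: "eta_prod ds $$ (0, 0) = e" and e: "e \<in> {1, - 1}"
  obtains a b x y where
    "eta_prod (a # ds @ [b]) = mat2 (- e) 0 0 (- e)"
    "eta_prod (x # es @ [y]) = mat2 (e * lam) 0 0 (e * lam)"
    "u = a + y" "v = b + x"
proof -
  obtain a b where A: "eta_prod (a # ds @ [b]) = mat2 (- e) 0 0 (- e)"
    using close_block[OF entry e] .
  define x where "x = v - b"
  define y where "y = u - a"
  have uv: "u = a + y" "v = b + x" by (simp_all add: x_def y_def)
  obtain p q r s where B: "eta_prod (y # x # es) = mat2 p q r s"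
    using eta_prod_carrier by (rule mat2_cases)
  from eta_prod_seams[OF A cycle[unfolded uv]]
  have "mat2 (- e) 0 0 (- e) * mat2 p q r s = mat2 (- lam) 0 0 (- lam)"
    unfolding B .
  with e have "mat2 p q r s = mat2 (e * lam) 0 0 (e * lam)"
    by auto
  with B have "eta_prod (y # x # es) = mat2 (e * lam) 0 0 (e * lam)" by simp
  from eta_prod_scalar_rotate1[OF this] A uv show ?thesis by (intro that) simp_all
qed

lemma quiddity_sum_blocks:
  "quiddity_sum (a # ds @ [b]) (x # es @ [y]) = (a + y) # ds @ (b + x) # es"
  by (simp add: quiddity_sum_def butlast_append)

lemma list_ends:
  assumes "length xs > 2"
  obtains a ds b where "xs = a # ds @ [b]" "ds \<noteq> []"
proof -
  obtain a zs where "xs = a # zs" using assms by (cases xs) auto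
  moreover from this assms obtain ds b where "zs = ds @ [b]" by (cases zs rule: rev_cases) auto
  ultimately show ?thesis using assms by (intro that[of a ds b]) auto
qed

section \<open>Windows of the periodic extension\<close>

lemma permute_list_affine:
  assumes "\<forall>i<length cs. int (\<sigma> i) = (a + s * int i) mod int (length cs)"
  shows "permute_list \<sigma> cs = map (\<lambda>i. periodic_ext cs (a + 1 + s * int i)) [0..<length cs]"
proof -
  have "\<sigma> i = nat ((a + s * int i) mod int (length cs))" if "i < length cs" for i
    using assms that by (metis nat_int)
  then show ?thesis by (simp add: permute_list_def periodic_ext_def)
qed

text \<open>
  One period, read from an arbitrary starting point, in two guises: as the image under an index
  permutation, in which reducibility is expressed, and as an iterated one-step rotation, under
  which scalar products are preserved.
\<close>
lemma window_rotation:
  assumes "cs \<noteq> []"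
  obtains \<sigma> n where "\<sigma> \<in> dihedral (length cs)"
    and "permute_list \<sigma> cs = map (periodic_ext cs) [k + 1..k + int (length cs)]"
    and "rotate n cs = map (periodic_ext cs) [k + 1..k + int (length cs)]"
proof -
  let ?m = "length cs"
  let ?w = "map (periodic_ext cs) [k + 1..k + int ?m]"
  have m: "?m > 0" using assms by simp
  define \<sigma> where "\<sigma> i = (if i < ?m then nat ((k + int i) mod int ?m) else i)" for i
  have \<sigma>: "int (\<sigma> i) = (k + 1 * int i) mod int ?m" if "i < ?m" for i
    using that m by (simp add: \<sigma>_def)
  have "\<sigma> permutes {..<?m}"
  proof (rule bij_imp_permutes)
    have "inj_on \<sigma> {..<?m}"
    proof (rule inj_onI)
      fix i j assume ij: "i \<in> {..<?m}" "j \<in> {..<?m}" "\<sigma> i = \<sigma> j"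
      then have "(k + int i) mod int ?m = (k + int j) mod int ?m"
        using \<sigma>[of i] \<sigma>[of j] by simp
      then have "int i mod int ?m = int j mod int ?m"
        by (metis add_diff_cancel_left' mod_diff_left_eq)
      with ij show "i = j" by simp
    qed
    moreover have "\<sigma> ` {..<?m} \<subseteq> {..<?m}"
      using m by (auto simp: \<sigma>_def nat_less_iff)
    ultimately show "bij_betw \<sigma> {..<?m} {..<?m}"
      by (simp add: bij_betw_def endo_inj_surj)
  qed (simp add: \<sigma>_def)
  with \<sigma> have "\<sigma> \<in> dihedral ?m" unfolding dihedral_def by blast
  moreover have "permute_list \<sigma> cs = ?w"
    using permute_list_affine[of cs \<sigma> k 1] \<sigma>
    by (intro nth_equalityI) (simp_all add: add.commute add.left_commute)
  moreover have "rotate (nat (k mod int ?m)) cs = ?w"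
  proof (rule nth_equalityI)
    fix i assume i: "i < length (rotate (nat (k mod int ?m)) cs)"
    have "int ((nat (k mod int ?m) + i) mod ?m) = (k + int i) mod int ?m"
      using m by (simp add: zmod_int mod_add_left_eq)
    then have "(nat (k mod int ?m) + i) mod ?m = nat ((k + int i) mod int ?m)"
      by (metis nat_int)
    with i show "rotate (nat (k mod int ?m)) cs ! i = ?w ! i"
      by (simp add: nth_rotate periodic_ext_def add.commute add.left_commute)
  qed simp
  ultimately show ?thesis by (rule that)
qed

section \<open>Reducibility and the frieze pattern\<close>

lemma frieze_eta_prod:
  "i + 2 \<le> j \<Longrightarrow> frieze cs i j = eta_prod (map (periodic_ext cs) [i..j - 2]) $$ (0, 0)"
  by (simp add: frieze_def)

text \<open>
  The block \<open>d\<close> of the first summand sits at positions \<open>1, \<dots>, n\<close> of the permuted cycle, counted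
  from 0.  A reflection lists the corresponding window of the periodic sequence backwards.
\<close>
lemma block_upper_left_frieze:
  assumes "\<sigma> \<in> dihedral (length cs)"
    and perm: "permute_list \<sigma> cs = u # ds @ v # es" and ds: "ds \<noteq> []"
  obtains i j where "j = i + int (length ds) + 1"
    and "frieze cs i j = eta_prod ds $$ (0, 0)"
proof -
  let ?n = "int (length ds)"
  obtain s a where s: "s \<in> {1, - 1}"
    and \<sigma>: "\<forall>i<length cs. int (\<sigma> i) = (a + s * int i) mod int (length cs)"
    using assms(1) unfolding dihedral_def by blast
  have len: "length cs = length ds + length es + 2"
    using arg_cong[OF perm, of length] by simp
  have nth: "ds ! t = periodic_ext cs (a + 1 + s * (int t + 1))" if "t < length ds" for t
  proof -
    have "ds ! t = permute_list \<sigma> cs ! Suc t"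
      using that by (simp add: perm nth_append)
    also have "\<dots> = periodic_ext cs (a + 1 + s * int (Suc t))"
      unfolding permute_list_affine[OF \<sigma>] using that len by (subst nth_map) (simp_all del: upt_Suc)
    finally show ?thesis by (simp add: add.commute)
  qed
  have pos: "length ds > 0" using ds by simp
  show ?thesis
  proof (cases "s = 1")
    case True
    have "map (periodic_ext cs) [a + 2..a + 3 + ?n - 2] = ds"
      using nth True by (intro nth_equalityI) (simp_all add: algebra_simps)
    moreover have "a + 2 + 2 \<le> a + 3 + ?n" using pos by linarith
    ultimately have "frieze cs (a + 2) (a + 3 + ?n) = eta_prod ds $$ (0, 0)"
      by (metis frieze_eta_prod)
    then show ?thesis by (intro that[of "a + 3 + ?n" "a + 2"]) simp_all
  next
    case False
    have "map (periodic_ext cs) [a + 1 - ?n..a + 2 - 2] = rev ds"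
      using nth False s by (intro nth_equalityI) (simp_all add: rev_nth algebra_simps of_nat_diff)
    moreover have "a + 1 - ?n + 2 \<le> a + 2" using pos by linarith
    ultimately have "frieze cs (a + 1 - ?n) (a + 2) = eta_prod ds $$ (0, 0)"
      by (metis frieze_eta_prod eta_prod_rev_upper_left)
    then show ?thesis by (intro that[of "a + 2" "a + 1 - ?n"]) simp_all
  qed
qed

theorem lemma2p13:
  fixes lam :: "'a::{comm_ring, comm_monoid_mult}" and cs :: "'a list"
  assumes "lam \<in> {1, - 1}"
    and "quiddity_cycle UNIV lam cs"
  shows "reducible UNIV lam cs \<longleftrightarrow>
    (\<exists>i j. i + 2 \<le> j \<and> j \<le> i + int (length cs) - 2 \<and> frieze cs i j \<in> {1, - 1})"
proof
  assume "reducible UNIV lam cs"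
  then obtain lam' lam'' as bs \<sigma> where \<sigma>: "\<sigma> \<in> dihedral (length cs)"
    and as: "quiddity_cycle UNIV lam' as" "length as > 2" and bs: "length bs > 2"
    and sum: "permute_list \<sigma> cs = quiddity_sum as bs"
    unfolding reducible_def by blast
  obtain a ds b where as_eq: "as = a # ds @ [b]" and ds: "ds \<noteq> []"
    using as(2) by (rule list_ends)
  obtain x es y where bs_eq: "bs = x # es @ [y]" and es: "es \<noteq> []"
    using bs by (rule list_ends)
  have perm: "permute_list \<sigma> cs = (a + y) # ds @ (b + x) # es"
    by (simp add: sum as_eq bs_eq quiddity_sum_blocks)
  have len: "length cs = length ds + length es + 2"
    using arg_cong[OF perm, of length] by simp
  obtain i j where ij: "j = i + int (length ds) + 1"
    and entry: "frieze cs i j = eta_prod ds $$ (0, 0)"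
    using block_upper_left_frieze[OF \<sigma> perm ds] .
  have "eta_prod ds $$ (0, 0) = - lam'"
    using as(1) unfolding as_eq quiddity_cycle_def scalar_mat2
    by (blast intro: eta_prod_enclosed_lower_right)
  moreover have "lam' \<in> {1, - 1}" using as(1) by (simp add: quiddity_cycle_def)
  ultimately have "frieze cs i j \<in> {1, - 1}" using entry by auto
  moreover have "length ds > 0" "length es > 0" using ds es by simp_all
  then have "i + 2 \<le> j" "j \<le> i + int (length cs) - 2"
    using ij len by linarith+
  ultimately show "\<exists>i j. i + 2 \<le> j \<and> j \<le> i + int (length cs) - 2 \<and> frieze cs i j \<in> {1, - 1}"
    by blast
next
  let ?m = "int (length cs)"
  let ?p = "periodic_ext cs"
  assume "\<exists>i j. i + 2 \<le> j \<and> j \<le> i + int (length cs) - 2 \<and> frieze cs i j \<in> {1, - 1}"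
  then obtain i j where ij: "i + 2 \<le> j" "j \<le> i + ?m - 2" and e: "frieze cs i j \<in> {1, - 1}"
    by blast
  define ds where "ds = map ?p [i..j - 2]"
  define es where "es = map ?p [j..i + ?m - 2]"
  define e where "e = eta_prod ds $$ (0, 0)"
  have e_sign: "e \<in> {1, - 1}" using e ij by (simp add: frieze_eta_prod ds_def e_def)
  have nonempty: "ds \<noteq> []" "es \<noteq> []" using ij by (simp_all add: ds_def es_def)
  have cs: "cs \<noteq> []" "eta_prod cs = mat2 lam 0 0 lam"
    using assms(2) by (simp_all add: quiddity_cycle_def scalar_mat2)
  obtain \<sigma> n where \<sigma>: "\<sigma> \<in> dihedral (length cs)"
    and perm: "permute_list \<sigma> cs = map ?p [i - 2 + 1..i - 2 + ?m]"
    and rot: "rotate n cs = map ?p [i - 2 + 1..i - 2 + ?m]"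
    using cs(1) by (rule window_rotation)
  have "[i - 2 + 1..i - 2 + ?m] = (i - 1) # [i..j - 2] @ (j - 1) # [j..i + ?m - 2]"
    using ij upto_rec1[of "i - 1" "i + ?m - 2"] upto_split1[of i "j - 1" "i + ?m - 2"]
      upto_rec1[of "j - 1" "i + ?m - 2"] by (simp add: algebra_simps)
  then have window: "map ?p [i - 2 + 1..i - 2 + ?m] = ?p (i - 1) # ds @ ?p (j - 1) # es"
    by (simp add: ds_def es_def)
  have "eta_prod (?p (i - 1) # ds @ ?p (j - 1) # es) = mat2 lam 0 0 lam"
    using eta_prod_scalar_rotate[OF cs(2), of n] by (simp only: rot window)
  then obtain a b x y where A: "eta_prod (a # ds @ [b]) = mat2 (- e) 0 0 (- e)"
    and B: "eta_prod (x # es @ [y]) = mat2 (e * lam) 0 0 (e * lam)"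
    and seams: "?p (i - 1) = a + y" "?p (j - 1) = b + x"
    using e_def[symmetric] e_sign by (rule split_cycle)
  have "quiddity_cycle UNIV (- e) (a # ds @ [b])"
    using A e_sign by (auto simp: quiddity_cycle_def scalar_mat2 simp del: eta_prod_Cons)
  moreover have "quiddity_cycle UNIV (e * lam) (x # es @ [y])"
    using B e_sign assms(1) by (auto simp: quiddity_cycle_def scalar_mat2 simp del: eta_prod_Cons)
  moreover have "lam = - (- e * (e * lam))"
    using e_sign by auto
  moreover have "length (a # ds @ [b]) > 2" "length (x # es @ [y]) > 2"
    using nonempty by simp_all
  moreover have "permute_list \<sigma> cs = quiddity_sum (a # ds @ [b]) (x # es @ [y])"
    by (simp only: perm window seams quiddity_sum_blocks)
  moreover have "length cs > 2" using ij by linarith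
  ultimately show "reducible UNIV lam cs"
    unfolding reducible_def using assms(2) \<sigma> by blast
qed

end
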